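(* The satisfiability problem for the class of formulae of the form $\varphi\wedge x_1\subseteq\mathrm{dom}(f_1)\wedge x_2\subseteq\mathrm{dom}(f_2)$, where $\varphi$ is a normalized $\forall^{\pi}_{0,2}$-conjunction, $x_1,x_2$ are set variables and $f_1,f_2$ are map variables, is undecidable.
   Context: Sets are the pure sets of the von Neumann hierarchy $\mathcal{V}$ (ZF with regularity). There are infinite disjoint collections of set variables and map variables. A pairing function is a binary operation $\pi$ on $\mathcal{V}$ with $\pi(u,v)=\pi(u',v')\iff u=u'\wedge v=v'$ and such that $\{\pi(u',v'):u'\in u,v'\in v\}$ is a set for all sets $u,v$. An interpretation $I=(M_I,\pi_I)$ is a pairing function $\pi_I$ plus an assignment $M_I$ of sets to variables such that every member of $M_If$ is of the form $\pi_I(a,b)$ for each map variable $f$; $Ix=M_Ix$, $I[x,y]=\pi_I(Ix,Iy)$. A $W$-variant of $I$ has the same pairing function and agrees with $I$ outside $W$. $\forall^{\pi}_{0,2}$: atomic formulae $x\in y$, $x=y$, $[x,y]\in f$, $f=g$ ($x,y$ set variables, $f,g$ map variables). A universal prenex formula is $(\forall x_1\in z_1)\cdots(\forall x_h\in z_h)(\forall[x_{h+1},y_{h+1}]\in f_{h+1})\cdots(\forall[x_n,y_n]\in f_n)\delta$ with $\delta$ a propositional combination of atomic formulae; $z_i$ are domain variables; it is simple if no quantified variable occurs as a domain variable. A normalized $\forall^{\pi}_{0,2}$-conjunction is a finite conjunction of simple universal prenex formulae. Semantics: standard meaning of $\in,=$; $I\models(\forall x\in z)\psi$ iff $J\models\psi$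 for every $\{x\}$-variant $J$ with $Jx\in Jz$; $I\models(\forall[x,y]\in f)\psi$ iff $J\models\psi$ for every $\{x,y\}$-variant $J$ with $\pi_J(Jx,Jy)\in Jf$. The literal $x\subseteq\mathrm{dom}(f)$ holds in $I$ iff $Ix\subseteq\{u\in\mathcal{V}:\pi_I(u,v)\in If\text{ for some }v\in\mathcal{V}\}$. The satisfiability problem asks, for a given formula, whether some interpretation satisfies it; undecidable means no algorithm solves it. *)

theory Defs
  imports Main "HOL-Library.Nat_Bijection"
begin

section \<open>The universe of pure sets\<close>

text \<open>
  HOL has no type of all ZF sets, so the von Neumann universe is an arbitrary type with a relation
  (\<open>E a b\<close> means that a is a member of b) satisfying the axioms of ZF with regularity.
  Replacement is the second-order axiom, ranging over all functional relations on the type.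
\<close>

locale zf_universe =
  fixes E :: "'v \<Rightarrow> 'v \<Rightarrow> bool"
  assumes extensionality: "(\<And>t. E t a \<longleftrightarrow> E t b) \<Longrightarrow> a = b"
    and regularity: "E t a \<Longrightarrow> \<exists>m. E m a \<and> \<not> (\<exists>s. E s m \<and> E s a)"
    and pairing: "\<exists>c. \<forall>t. E t c \<longleftrightarrow> t = a \<or> t = b"
    and union: "\<exists>c. \<forall>t. E t c \<longleftrightarrow> (\<exists>s. E s a \<and> E t s)"
    and power: "\<exists>c. \<forall>t. E t c \<longleftrightarrow> (\<forall>s. E s t \<longrightarrow> E s a)"
    and infinity: "\<exists>c. (\<exists>e. E e c \<and> (\<forall>t. \<not> E t e)) \<and>
      (\<forall>s. E s c \<longrightarrow> (\<exists>s'. E s' c \<and> (\<forall>t. E t s' \<longleftrightarrow> E t s \<or> t = s)))"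
    and replacement:
      "(\<And>s t t'. E s a \<Longrightarrow> R s t \<Longrightarrow> R s t' \<Longrightarrow> t = t') \<Longrightarrow>
        \<exists>c. \<forall>t. E t c \<longleftrightarrow> (\<exists>s. E s a \<and> R s t)"

definition pairing_function :: "('v \<Rightarrow> 'v \<Rightarrow> bool) \<Rightarrow> ('v \<Rightarrow> 'v \<Rightarrow> 'v) \<Rightarrow> bool" where
  "pairing_function E \<pi> \<longleftrightarrow>
    (\<forall>u v u' v'. \<pi> u v = \<pi> u' v' \<longleftrightarrow> u = u' \<and> v = v') \<and>
    (\<forall>u v. \<exists>w. \<forall>t. E t w \<longleftrightarrow> (\<exists>u' v'. E u' u \<and> E v' v \<and> t = \<pi> u' v'))"


section \<open>Syntax\<close>

text \<open>The two sorts of variables are kept apart by the positions in which they occur.\<close>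

type_synonym svar = nat
type_synonym mvar = nat

datatype atom =
    Mem svar svar
  | SEq svar svar
  | PairMem svar svar mvar
  | MEq mvar mvar

datatype bform =
    Atom atom
  | Neg bform
  | Conj bform bform
  | Disj bform bform
  | Imp bform bform
  | Iff bform bform

text \<open>
  In \<open>Prenex qs ps \<delta>\<close>, an entry (x, z) of qs is the quantifier
  \<open>\<forall>x \<in> z\<close> and an entry (x, y, f) of ps is \<open>\<forall>[x, y] \<in> f\<close>; all entries of qs precede
  those of ps, and the head of each list is its outermost quantifier.
\<close>

datatype prenex = Prenex "(svar \<times> svar) list" "(svar \<times> svar \<times> mvar) list" bform

fun quantified_vars :: "prenex \<Rightarrow> svar set" where
  "quantified_vars (Prenex qs ps \<delta>) =
    {x. \<exists>z. (x, z) \<in> set qs} \<union> {x. \<exists>y f. (x, y, f) \<in> set ps} \<union> {y. \<exists>x f. (x, y, f) \<in> set ps}"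

text \<open>Map variables are never quantified, so only the set variables among the domain variables matter.\<close>

fun domain_vars :: "prenex \<Rightarrow> svar set" where
  "domain_vars (Prenex qs ps \<delta>) = {z. \<exists>x. (x, z) \<in> set qs}"

definition simple :: "prenex \<Rightarrow> bool" where
  "simple \<psi> \<longleftrightarrow> quantified_vars \<psi> \<inter> domain_vars \<psi> = {}"

definition normalized_conjunction :: "prenex list \<Rightarrow> bool" where
  "normalized_conjunction \<phi> \<longleftrightarrow> (\<forall>\<psi> \<in> set \<phi>. simple \<psi>)"

text \<open>
  \<open>WithDom \<phi> x\<^sub>1 f\<^sub>1 x\<^sub>2 f\<^sub>2\<close> is the conjunction of the formulae in \<open>\<phi>\<close> and the two literals
  \<open>x\<^sub>1 \<subseteq> dom(f\<^sub>1)\<close> and \<open>x\<^sub>2 \<subseteq> dom(f\<^sub>2)\<close>.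
\<close>

datatype formula = WithDom "prenex list" svar mvar svar mvar

definition dom_formulae :: "formula set" where
  "dom_formulae = {WithDom \<phi> x\<^sub>1 f\<^sub>1 x\<^sub>2 f\<^sub>2 | \<phi> x\<^sub>1 f\<^sub>1 x\<^sub>2 f\<^sub>2. normalized_conjunction \<phi>}"


section \<open>Semantics\<close>

record 'v interp =
  sval :: "svar \<Rightarrow> 'v"
  mval :: "mvar \<Rightarrow> 'v"
  pair :: "'v \<Rightarrow> 'v \<Rightarrow> 'v"

definition interpretation_in :: "('v \<Rightarrow> 'v \<Rightarrow> bool) \<Rightarrow> 'v interp \<Rightarrow> bool" where
  "interpretation_in E I \<longleftrightarrow>
    pairing_function E (pair I) \<and> (\<forall>f t. E t (mval I f) \<longrightarrow> (\<exists>a b. t = pair I a b))"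

text \<open>
  Variants are only needed for sets W of set variables. A variant of an interpretation is again an
  interpretation, because pairing function and map variables are unchanged.
\<close>

definition variant :: "svar set \<Rightarrow> 'v interp \<Rightarrow> 'v interp \<Rightarrow> bool" where
  "variant W I J \<longleftrightarrow>
    pair J = pair I \<and> mval J = mval I \<and> (\<forall>x. x \<notin> W \<longrightarrow> sval J x = sval I x)"

fun sat_atom :: "('v \<Rightarrow> 'v \<Rightarrow> bool) \<Rightarrow> 'v interp \<Rightarrow> atom \<Rightarrow> bool" where
  "sat_atom E I (Mem x y) \<longleftrightarrow> E (sval I x) (sval I y)"
| "sat_atom E I (SEq x y) \<longleftrightarrow> sval I x = sval I y"
| "sat_atom E I (PairMem x y f) \<longleftrightarrow> E (pair I (sval I x) (sval I y)) (mval I f)"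
| "sat_atom E I (MEq f g) \<longleftrightarrow> mval I f = mval I g"

fun sat_bform :: "('v \<Rightarrow> 'v \<Rightarrow> bool) \<Rightarrow> 'v interp \<Rightarrow> bform \<Rightarrow> bool" where
  "sat_bform E I (Atom a) \<longleftrightarrow> sat_atom E I a"
| "sat_bform E I (Neg p) \<longleftrightarrow> \<not> sat_bform E I p"
| "sat_bform E I (Conj p q) \<longleftrightarrow> sat_bform E I p \<and> sat_bform E I q"
| "sat_bform E I (Disj p q) \<longleftrightarrow> sat_bform E I p \<or> sat_bform E I q"
| "sat_bform E I (Imp p q) \<longleftrightarrow> (sat_bform E I p \<longrightarrow> sat_bform E I q)"
| "sat_bform E I (Iff p q) \<longleftrightarrow> (sat_bform E I p \<longleftrightarrow> sat_bform E I q)"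

fun sat_quantified ::
    "('v \<Rightarrow> 'v \<Rightarrow> bool) \<Rightarrow> 'v interp \<Rightarrow> (svar \<times> svar) list \<Rightarrow> (svar \<times> svar \<times> mvar) list \<Rightarrow> bform \<Rightarrow> bool"
where
  "sat_quantified E I [] [] \<delta> \<longleftrightarrow> sat_bform E I \<delta>"
| "sat_quantified E I [] ((x, y, f) # ps) \<delta> \<longleftrightarrow>
    (\<forall>J. variant {x, y} I J \<and> E (pair J (sval J x) (sval J y)) (mval J f) \<longrightarrow>
      sat_quantified E J [] ps \<delta>)"
| "sat_quantified E I ((x, z) # qs) ps \<delta> \<longleftrightarrow>
    (\<forall>J. variant {x} I J \<and> E (sval J x) (sval J z) \<longrightarrow> sat_quantified E J qs ps \<delta>)"

fun sat_prenex :: "('v \<Rightarrow> 'v \<Rightarrow> bool) \<Rightarrow> 'v interp \<Rightarrow> prenex \<Rightarrow> bool" where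
  "sat_prenex E I (Prenex qs ps \<delta>) \<longleftrightarrow> sat_quantified E I qs ps \<delta>"

definition sat_subset_dom :: "('v \<Rightarrow> 'v \<Rightarrow> bool) \<Rightarrow> 'v interp \<Rightarrow> svar \<Rightarrow> mvar \<Rightarrow> bool" where
  "sat_subset_dom E I x f \<longleftrightarrow>
    {u. E u (sval I x)} \<subseteq> {u. \<exists>v. E (pair I u v) (mval I f)}"

fun sat_formula :: "('v \<Rightarrow> 'v \<Rightarrow> bool) \<Rightarrow> 'v interp \<Rightarrow> formula \<Rightarrow> bool" where
  "sat_formula E I (WithDom \<phi> x\<^sub>1 f\<^sub>1 x\<^sub>2 f\<^sub>2) \<longleftrightarrow>
    (\<forall>\<psi> \<in> set \<phi>. sat_prenex E I \<psi>) \<and> sat_subset_dom E I x\<^sub>1 f\<^sub>1 \<and> sat_subset_dom E I x\<^sub>2 f\<^sub>2"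

definition satisfiable :: "('v \<Rightarrow> 'v \<Rightarrow> bool) \<Rightarrow> formula \<Rightarrow> bool" where
  "satisfiable E \<chi> \<longleftrightarrow> (\<exists>I. interpretation_in E I \<and> sat_formula E I \<chi>)"


section \<open>Algorithms\<close>

text \<open>
  Algorithms are Kleene's partial recursive functions; \<open>rec_eval p xs y\<close> says that p halts on the
  arguments xs with value y. In \<open>Prec\<close> the recursion argument comes first, as does the argument
  searched for by \<open>Mu\<close>.
\<close>

datatype recf =
    Zero
  | Succ
  | Proj nat
  | Comp recf "recf list"
  | Prec recf recf
  | Mu recf

inductive rec_eval :: "recf \<Rightarrow> nat list \<Rightarrow> nat \<Rightarrow> bool" where
  Zero: "rec_eval Zero xs 0"
| Succ: "rec_eval Succ [x] (Suc x)"
| Proj: "i < length xs \<Longrightarrow> rec_eval (Proj i) xs (xs ! i)"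
| Comp: "list_all2 (\<lambda>g y. rec_eval g xs y) gs ys \<Longrightarrow> rec_eval f ys z \<Longrightarrow> rec_eval (Comp f gs) xs z"
| Prec_0: "rec_eval f xs y \<Longrightarrow> rec_eval (Prec f g) (0 # xs) y"
| Prec_Suc: "rec_eval (Prec f g) (n # xs) y \<Longrightarrow> rec_eval g (n # y # xs) z \<Longrightarrow>
    rec_eval (Prec f g) (Suc n # xs) z"
| Mu: "rec_eval f (n # xs) 0 \<Longrightarrow> (\<forall>i<n. \<exists>y. rec_eval f (i # xs) (Suc y)) \<Longrightarrow> rec_eval (Mu f) xs n"

lemma rec_eval_deterministic: "rec_eval p xs y \<Longrightarrow> rec_eval p xs z \<Longrightarrow> y = z"
proof (induction arbitrary: z rule: rec_eval.induct)
  case (Comp xs gs ys f y)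
  from Comp.prems obtain ys' where ys': "list_all2 (\<lambda>g y. rec_eval g xs y) gs ys'" "rec_eval f ys' z"
    by (cases rule: rec_eval.cases) auto
  have "ys = ys'"
    using Comp.IH(1) ys'(1) by (auto simp: list_all2_conv_all_nth intro!: nth_equalityI)
  then show ?case using Comp.IH(2) ys'(2) by blast
next
  case (Prec_0 f xs y g)
  from Prec_0.prems show ?case by (cases rule: rec_eval.cases) (auto intro: Prec_0.IH)
next
  case (Prec_Suc f g n xs y w)
  from Prec_Suc.prems show ?case
    by (cases rule: rec_eval.cases) (use Prec_Suc.IH in blast)
next
  case (Mu f n xs)
  from Mu.prems have z: "rec_eval f (z # xs) 0" "\<forall>i<z. \<exists>y. rec_eval f (i # xs) (Suc y)"
    by (cases rule: rec_eval.cases, auto)+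
  show ?case
  proof (rule linorder_cases[of n z])
    assume "n < z"
    then show ?thesis using z(2) Mu.IH(1) by blast
  next
    assume "z < n"
    then show ?thesis using z(1) Mu.IH(2) by fastforce
  qed simp
qed (auto elim: rec_eval.cases)

text \<open>
  A decision problem consists of a set D of instances, a numerical coding of instances and the
  property P to be decided. An algorithm solving it must halt with the right answer on (the code of)
  every instance; nothing is required of it on other numbers.
\<close>

definition decidable_problem :: "('a \<Rightarrow> nat) \<Rightarrow> 'a set \<Rightarrow> ('a \<Rightarrow> bool) \<Rightarrow> bool" where
  "decidable_problem code D P \<longleftrightarrow>
    (\<exists>p. \<forall>a \<in> D. rec_eval p [code a] (if P a then 1 else 0))"


section \<open>Goedel numbering of formulae\<close>

fun code_atom :: "atom \<Rightarrow> nat" where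
  "code_atom (Mem x y) = prod_encode (0, prod_encode (x, y))"
| "code_atom (SEq x y) = prod_encode (1, prod_encode (x, y))"
| "code_atom (PairMem x y f) = prod_encode (2, prod_encode (x, prod_encode (y, f)))"
| "code_atom (MEq f g) = prod_encode (3, prod_encode (f, g))"

fun code_bform :: "bform \<Rightarrow> nat" where
  "code_bform (Atom a) = prod_encode (0, code_atom a)"
| "code_bform (Neg p) = prod_encode (1, code_bform p)"
| "code_bform (Conj p q) = prod_encode (2, prod_encode (code_bform p, code_bform q))"
| "code_bform (Disj p q) = prod_encode (3, prod_encode (code_bform p, code_bform q))"
| "code_bform (Imp p q) = prod_encode (4, prod_encode (code_bform p, code_bform q))"
| "code_bform (Iff p q) = prod_encode (5, prod_encode (code_bform p, code_bform q))"

fun code_prenex :: "prenex \<Rightarrow> nat" where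
  "code_prenex (Prenex qs ps \<delta>) =
    prod_encode (list_encode (map prod_encode qs),
      prod_encode (list_encode (map (\<lambda>(x, y, f). prod_encode (x, prod_encode (y, f))) ps),
        code_bform \<delta>))"

fun code_formula :: "formula \<Rightarrow> nat" where
  "code_formula (WithDom \<phi> x\<^sub>1 f\<^sub>1 x\<^sub>2 f\<^sub>2) =
    prod_encode (list_encode (map code_prenex \<phi>),
      prod_encode (prod_encode (x\<^sub>1, f\<^sub>1), prod_encode (x\<^sub>2, f\<^sub>2)))"

lemma code_atom_eq_iff: "code_atom a = code_atom b \<longleftrightarrow> a = b"
  by (cases a; cases b) auto

lemma code_bform_eq_iff: "code_bform p = code_bform q \<longleftrightarrow> p = q"
proof (induction p arbitrary: q)
  case (Atom a)
  then show ?case by (cases q) (auto simp: code_atom_eq_iff)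
next
  case (Neg p)
  then show ?case by (cases q) auto
next
  case (Conj p1 p2)
  then show ?case by (cases q) auto
next
  case (Disj p1 p2)
  then show ?case by (cases q) auto
next
  case (Imp p1 p2)
  then show ?case by (cases q) auto
next
  case (Iff p1 p2)
  then show ?case by (cases q) auto
qed

lemma inj_code_prenex: "inj code_prenex"
proof (rule injI)
  fix \<phi> \<psi>
  assume "code_prenex \<phi> = code_prenex \<psi>"
  moreover have "inj (\<lambda>(x, y, f). prod_encode (x, prod_encode (y, f)))"
    by (auto simp: inj_def)
  ultimately show "\<phi> = \<psi>"
    by (cases \<phi>; cases \<psi>) (auto simp: code_bform_eq_iff inj_map_eq_map inj_prod_encode list_encode_eq)
qed

lemma inj_code_formula: "inj code_formula"
proof (rule injI)
  fix \<chi> \<chi>'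
  assume "code_formula \<chi> = code_formula \<chi>'"
  then show "\<chi> = \<chi>'"
    by (cases \<chi>; cases \<chi>') (auto simp: inj_map_eq_map inj_code_prenex list_encode_eq)
qed

end

theory Submission
  imports Defs "HOL-Library.Countable"
begin

text \<open>
  The evaluation of a partial recursive function q is described by Horn clauses with binary relations
  over a chain of elements, the \<open>numerals\<close>: the chain is produced by one literal
  \<open>x \<subseteq> dom(S)\<close>, and the Cantor enumeration, which is definable from S by Horn clauses, makes
  every numeral the code of a list of numerals. So binary relations suffice to express that q
  halts on a list of arguments. A formula excluding that q halts on n is satisfiable iff q diverges
  on n: a halting computation can be replayed in every model, and otherwise the true relations on the
  natural numbers give a model. As the part of the formula that depends on n is separate from the part
  that depends on q, a decision procedure can be diagonalised by taking for n the code
  of the part that depends on q.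
\<close>

section \<open>Horn clauses for recursive functions\<close>

text \<open>Countability lets \<open>to_nat\<close> turn relation symbols into map
  variables.\<close>

instance recf :: countable
  by countable_datatype

datatype rel = SuccR | HeadR | TailR | HaltR | EvalR recf | EvalsR "recf list" | BelowR recf

instance rel :: countable
  by countable_datatype

text \<open>The variable 0 of a clause stands for the number 0.\<close>

type_synonym literal = "rel \<times> nat \<times> nat"
type_synonym horn = "literal list \<times> literal"

definition horn_true :: "(rel \<Rightarrow> nat \<Rightarrow> nat \<Rightarrow> bool) \<Rightarrow> horn \<Rightarrow> bool" where
  "horn_true M = (\<lambda>(ps, (r, i, j)).
    \<forall>w. w 0 = 0 \<longrightarrow> (\<forall>(s, k, l) \<in> set ps. M s (w k) (w l)) \<longrightarrow> M r (w i) (w j))"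

lemma horn_trueD:
  assumes "horn_true M (ps, (r, i, j))" "w 0 = 0" "\<forall>(s, k, l) \<in> set ps. M s (w k) (w l)"
  shows "M r (w i) (w j)"
  using assms unfolding horn_true_def by simp

text \<open>
  \<open>list_encode\<close> enumerates the pairs of head and tail along the diagonals: the pair after
  \<open>(a, b + 1)\<close> is \<open>(a + 1, b)\<close>, and the one after \<open>(a, 0)\<close> is \<open>(0, a + 1)\<close>.
\<close>

definition list_clauses :: "horn list" where
  "list_clauses =
    [([(SuccR, 0, 1)], (HeadR, 1, 0)),
     ([(SuccR, 0, 1)], (TailR, 1, 0)),
     ([(HeadR, 1, 2), (TailR, 1, 3), (SuccR, 4, 3), (SuccR, 1, 5), (SuccR, 2, 6)], (HeadR, 5, 6)),
     ([(HeadR, 1, 2), (TailR, 1, 3), (SuccR, 4, 3), (SuccR, 1, 5), (SuccR, 2, 6)], (TailR, 5, 4)),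
     ([(HeadR, 1, 2), (TailR, 1, 0), (SuccR, 1, 3), (SuccR, 2, 4)], (HeadR, 3, 0)),
     ([(HeadR, 1, 2), (TailR, 1, 0), (SuccR, 1, 3), (SuccR, 2, 4)], (TailR, 3, 4))]"

text \<open>In every clause variable 1 codes the argument list. As there are no function symbols,
  any other list gets a variable of its own, tied down by \<open>HeadR\<close> and
  \<open>TailR\<close>: in the step clause of \<open>Prec\<close>, variables 5, 7 and 8 code
  \<open>n # xs\<close>, \<open>y # xs\<close> and \<open>n # y # xs\<close>.\<close>

function eval_clauses :: "recf \<Rightarrow> horn list" and evals_clauses :: "recf list \<Rightarrow> horn list" where
  "eval_clauses Zero = [([], (EvalR Zero, 1, 0))]"
| "eval_clauses Succ = [([(HeadR, 1, 2), (TailR, 1, 0), (SuccR, 2, 3)], (EvalR Succ, 1, 3))]"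
| "eval_clauses (Proj i) =
    ([(HeadR, 1, 2)], (EvalR (Proj 0), 1, 2)) #
    map (\<lambda>k. ([(TailR, 1, 2), (EvalR (Proj k), 2, 3)], (EvalR (Proj (Suc k)), 1, 3))) [0..<i]"
| "eval_clauses (Comp f gs) =
    ([(EvalsR gs, 1, 2), (EvalR f, 2, 3)], (EvalR (Comp f gs), 1, 3)) #
    eval_clauses f @ evals_clauses gs"
| "eval_clauses (Prec f g) =
    ([(HeadR, 1, 0), (TailR, 1, 2), (EvalR f, 2, 3)], (EvalR (Prec f g), 1, 3)) #
    ([(HeadR, 1, 2), (TailR, 1, 3), (SuccR, 4, 2),
      (HeadR, 5, 4), (TailR, 5, 3), (EvalR (Prec f g), 5, 6),
      (HeadR, 7, 6), (TailR, 7, 3), (HeadR, 8, 4), (TailR, 8, 7), (EvalR g, 8, 9)],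
     (EvalR (Prec f g), 1, 9)) #
    eval_clauses f @ eval_clauses g"
| "eval_clauses (Mu f) =
    ([], (BelowR f, 1, 0)) #
    ([(BelowR f, 1, 2), (HeadR, 3, 2), (TailR, 3, 1), (EvalR f, 3, 4), (SuccR, 5, 4), (SuccR, 2, 6)],
     (BelowR f, 1, 6)) #
    ([(BelowR f, 1, 2), (HeadR, 3, 2), (TailR, 3, 1), (EvalR f, 3, 0)], (EvalR (Mu f), 1, 2)) #
    eval_clauses f"
| "evals_clauses [] = [([], (EvalsR [], 1, 0))]"
| "evals_clauses (g # gs) =
    ([(EvalR g, 1, 2), (EvalsR gs, 1, 3), (HeadR, 4, 2), (TailR, 4, 3)], (EvalsR (g # gs), 1, 4)) #
    eval_clauses g @ evals_clauses gs"
  by pat_completeness auto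
termination
  by (relation "measure (case_sum size (size_list size))") auto

text \<open>Variable 1 codes the one-element list of the input, as 0 codes the empty list. Halting,
  a unary property, is put on the diagonal of a binary relation.\<close>

definition halt_clauses :: "recf \<Rightarrow> horn list" where
  "halt_clauses q =
    ([(HeadR, 1, 2), (TailR, 1, 0), (EvalR q, 1, 3)], (HaltR, 2, 2)) #
    list_clauses @ eval_clauses q"

section \<open>Truth of the clauses in the natural numbers\<close>

fun std_rel :: "recf \<Rightarrow> rel \<Rightarrow> nat \<Rightarrow> nat \<Rightarrow> bool" where
  "std_rel q SuccR a b \<longleftrightarrow> b = Suc a"
| "std_rel q HeadR a b \<longleftrightarrow> (\<exists>xs. list_decode a = b # xs)"
| "std_rel q TailR a b \<longleftrightarrow> (\<exists>x. list_decode a = x # list_decode b)"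
| "std_rel q HaltR a b \<longleftrightarrow> a = b \<and> (\<exists>y. rec_eval q [a] y)"
| "std_rel q (EvalR g) a b \<longleftrightarrow> rec_eval g (list_decode a) b"
| "std_rel q (EvalsR gs) a b \<longleftrightarrow> list_all2 (\<lambda>g y. rec_eval g (list_decode a) y) gs (list_decode b)"
| "std_rel q (BelowR f) a b \<longleftrightarrow> (\<forall>i<b. \<exists>y. rec_eval f (i # list_decode a) (Suc y))"

lemma prod_decode_Suc:
  "prod_decode (Suc n) = (case prod_decode n of (a, 0) \<Rightarrow> (0, Suc a) | (a, Suc b) \<Rightarrow> (Suc a, b))"
proof -
  obtain a b where ab: "prod_decode n = (a, b)" by fastforce
  then have n: "n = prod_encode (a, b)" by (metis prod_decode_inverse)
  have "Suc n = prod_encode (case b of 0 \<Rightarrow> (0, Suc a) | Suc b' \<Rightarrow> (Suc a, b'))"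
    by (auto simp: n prod_encode_def split: nat.split)
  then have "prod_decode (Suc n) = (case b of 0 \<Rightarrow> (0, Suc a) | Suc b' \<Rightarrow> (Suc a, b'))"
    by (simp only: prod_encode_inverse)
  then show ?thesis by (simp add: ab split: nat.split)
qed

text \<open>\<open>list_encode\<close> maps a nonempty list to the successor of the pair of its head
  and the code of its tail.\<close>

lemma std_HeadR_iff: "std_rel q HeadR a b \<longleftrightarrow> (\<exists>n. a = Suc n \<and> b = fst (prod_decode n))"
  by (cases a) (auto split: prod.splits)

lemma list_decode_eq_iff: "list_decode m = list_decode n \<longleftrightarrow> m = n"
  by (metis list_decode_inverse)

lemma std_TailR_iff: "std_rel q TailR a b \<longleftrightarrow> (\<exists>n. a = Suc n \<and> b = snd (prod_decode n))"
  by (cases a) (auto simp: list_decode_eq_iff split: prod.splits)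

lemma std_list_clauses: "h \<in> set list_clauses \<Longrightarrow> horn_true (std_rel q) h"
proof -
  have "prod_decode 0 = (0, 0)" by (simp add: prod_decode_def prod_decode_aux.simps)
  moreover assume "h \<in> set list_clauses"
  ultimately show ?thesis
    unfolding list_clauses_def horn_true_def
    by (auto simp: std_HeadR_iff std_TailR_iff prod_decode_Suc
        simp del: std_rel.simps(2,3) split: prod.splits nat.splits)
qed

text \<open>Every clause mirrors an introduction rule of \<open>rec_eval\<close>, or a small step of
  one for projections, searches and lists of programs. The induction runs over subprograms because
  their clauses are included.\<close>

lemma std_eval_clauses:
  "h \<in> set (eval_clauses g) \<Longrightarrow> horn_true (std_rel q) h"
  "h \<in> set (evals_clauses gs) \<Longrightarrow> horn_true (std_rel q) h"
proof (induction g and gs rule: eval_clauses_evals_clauses.induct)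
  case 1
  then show ?case by (auto simp: horn_true_def intro: rec_eval.intros)
next
  case 2
  then show ?case by (auto simp: horn_true_def intro: rec_eval.intros)
next
  case (3 i)
  have "rec_eval (Proj 0) (x # xs) x" for x xs
    using rec_eval.Proj[of 0 "x # xs"] by simp
  moreover have "rec_eval (Proj (Suc k)) (x # xs) y" if "rec_eval (Proj k) xs y" for k x xs y
    using that rec_eval.Proj[of "Suc k" "x # xs"] by (auto elim: rec_eval.cases)
  ultimately show ?case using 3 by (auto simp: horn_true_def)
next
  case (4 f gs)
  then show ?case by (auto simp: horn_true_def intro: rec_eval.intros)
next
  case (5 f g)
  \<comment> \<open>In the clause the list \<open>y # xs\<close> is known only as the decoding of
    variable 7, hence the separate equation with \<open>ys\<close>.\<close>
  have "rec_eval (Prec f g) (Suc n # xs) z"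
    if "rec_eval (Prec f g) (n # xs) y" "rec_eval g (n # ys) z" "y # xs = ys" for n xs y ys z
    using that rec_eval.Prec_Suc by blast
  then have "horn_true (std_rel q)
     ([(HeadR, 1, 2), (TailR, 1, 3), (SuccR, 4, 2),
       (HeadR, 5, 4), (TailR, 5, 3), (EvalR (Prec f g), 5, 6),
       (HeadR, 7, 6), (TailR, 7, 3), (HeadR, 8, 4), (TailR, 8, 7), (EvalR g, 8, 9)],
      (EvalR (Prec f g), 1, 9))"
    by (auto simp: horn_true_def)
  moreover have "horn_true (std_rel q)
      ([(HeadR, 1, 0), (TailR, 1, 2), (EvalR f, 2, 3)], (EvalR (Prec f g), 1, 3))"
    by (auto simp: horn_true_def intro: rec_eval.Prec_0)
  ultimately show ?case using 5 by auto
next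
  case (6 f)
  have "horn_true (std_rel q) ([], (BelowR f, 1, 0))"
    by (simp add: horn_true_def)
  moreover have "horn_true (std_rel q)
      ([(BelowR f, 1, 2), (HeadR, 3, 2), (TailR, 3, 1), (EvalR f, 3, 4), (SuccR, 5, 4), (SuccR, 2, 6)],
       (BelowR f, 1, 6))"
    by (auto simp: horn_true_def less_Suc_eq)
  moreover have "horn_true (std_rel q)
      ([(BelowR f, 1, 2), (HeadR, 3, 2), (TailR, 3, 1), (EvalR f, 3, 0)], (EvalR (Mu f), 1, 2))"
    by (auto simp: horn_true_def intro!: rec_eval.Mu)
  ultimately show ?case using 6 by auto
next
  case 7
  then show ?case by (auto simp: horn_true_def)
next
  case (8 g gs)
  then show ?case by (auto simp: horn_true_def)
qed

lemma std_halt_clauses: "h \<in> set (halt_clauses q) \<Longrightarrow> horn_true (std_rel q) h"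
proof -
  have "horn_true (std_rel q) ([(HeadR, 1, 2), (TailR, 1, 0), (EvalR q, 1, 3)], (HaltR, 2, 2))"
    by (auto simp: horn_true_def)
  moreover assume "h \<in> set (halt_clauses q)"
  ultimately show ?thesis
    using std_list_clauses[of h q] std_eval_clauses(1)[of h q q] by (auto simp: halt_clauses_def)
qed

section \<open>Replaying computations in an arbitrary model of the clauses\<close>

context
  fixes M :: "rel \<Rightarrow> nat \<Rightarrow> nat \<Rightarrow> bool"
  assumes succ: "M SuccR n (Suc n)"
    and list_true: "h \<in> set list_clauses \<Longrightarrow> horn_true M h"
begin

text \<open>Induction along the Cantor enumeration: the clauses pass from the components of one
  numeral to those of the next.\<close>

lemma derive_head_tail:
  "M HeadR (Suc n) (fst (prod_decode n)) \<and> M TailR (Suc n) (snd (prod_decode n))"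
proof (induction n)
  case 0
  have "prod_decode 0 = (0, 0)" by (simp add: prod_decode_def prod_decode_aux.simps)
  then show ?case
    using horn_trueD[OF list_true, of "[(SuccR, 0, 1)]" HeadR 1 0 "\<lambda>i. i"]
      horn_trueD[OF list_true, of "[(SuccR, 0, 1)]" TailR 1 0 "\<lambda>i. i"]
    by (simp add: list_clauses_def succ[of 0, simplified])
next
  case (Suc n)
  obtain a b where ab: "prod_decode n = (a, b)" by fastforce
  note facts = Suc[unfolded ab fst_conv snd_conv] succ
  show ?case
  proof (cases b)
    case 0
    \<comment> \<open>The list gives the values of the clause variables 0, 1, 2 and so on, here and
      in the later derivations.\<close>
    let ?w = "(!) [0, Suc n, a, Suc (Suc n), Suc a]"
    let ?ps = "[(HeadR, 1, 2), (TailR, 1, 0), (SuccR, 1, 3), (SuccR, 2, 4)]"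
    show ?thesis
      using horn_trueD[OF list_true, of ?ps HeadR 3 0 ?w] horn_trueD[OF list_true, of ?ps TailR 3 4 ?w]
      by (simp add: list_clauses_def prod_decode_Suc ab 0 facts[unfolded 0])
  next
    case b: (Suc b')
    let ?w = "(!) [0, Suc n, a, b, b', Suc (Suc n), Suc a]"
    let ?ps = "[(HeadR, 1, 2), (TailR, 1, 3), (SuccR, 4, 3), (SuccR, 1, 5), (SuccR, 2, 6)]"
    show ?thesis
      using horn_trueD[OF list_true, of ?ps HeadR 5 6 ?w] horn_trueD[OF list_true, of ?ps TailR 5 4 ?w]
      by (simp add: list_clauses_def prod_decode_Suc ab b facts[unfolded b])
  qed
qed

text \<open>Thus each list that a clause asks for is already coded by some numeral, and the chain
  supplies every witness.\<close>

lemma derive_Cons: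
  "M HeadR (list_encode (x # xs)) x" "M TailR (list_encode (x # xs)) (list_encode xs)"
  using derive_head_tail[of "prod_encode (x, list_encode xs)"] by auto

text \<open>Induction on the computation: each evaluation rule is replayed by clauses whose
  valuation names the codes of the lists involved. The assumption on the clauses stays in the goal
  because the program changes in the induction.\<close>

lemma derive_eval:
  "rec_eval g xs y \<Longrightarrow> (\<And>h. h \<in> set (eval_clauses g) \<Longrightarrow> horn_true M h) \<Longrightarrow>
    M (EvalR g) (list_encode xs) y"
proof (induction rule: rec_eval.induct)
  case (Zero xs)
  show ?case
    using horn_trueD[OF Zero, of "[]" "EvalR Zero" 1 0 "(!) [0, list_encode xs]"] by simp
next
  case (Succ x)
  let ?ps = "[(HeadR, 1, 2), (TailR, 1, 0), (SuccR, 2, 3)]"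
  show ?case
    using horn_trueD[OF Succ, of ?ps "EvalR Succ" 1 3 "(!) [0, list_encode [x], x, Suc x]"]
      derive_Cons[of x "[]"] succ[of x] by simp
next
  case (Proj i xs)
  \<comment> \<open>The clauses of \<open>Proj i\<close> include those of all smaller indices;
    removing the head of the list lowers the index by one.\<close>
  have "M (EvalR (Proj k)) (list_encode zs) (zs ! k)" if "k \<le> i" "k < length zs" for k zs
    using that
  proof (induction k arbitrary: zs)
    case 0
    then obtain z zs' where zs: "zs = z # zs'" by (cases zs) auto
    show ?case
      using horn_trueD[OF Proj(2), of "[(HeadR, 1, 2)]" "EvalR (Proj 0)" 1 2 "(!) [0, list_encode zs, z]"]
        derive_Cons[of z zs'] by (simp add: zs)
  next
    case (Suc k)
    then obtain z zs' where zs: "zs = z # zs'" by (cases zs) auto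
    let ?ps = "[(TailR, 1, 2), (EvalR (Proj k), 2, 3)]"
    show ?case
      using horn_trueD[OF Proj(2), of ?ps "EvalR (Proj (Suc k))" 1 3
          "(!) [0, list_encode zs, list_encode zs', zs' ! k]"]
        derive_Cons[of z zs'] Suc by (simp add: zs)
  qed
  then show ?case using Proj(1) by simp
next
  case (Comp xs gs ys f z)
  have "M (EvalsR hs) (list_encode xs) (list_encode ws)"
    if "list_all2 (\<lambda>g y. rec_eval g xs y \<and> ((\<forall>h \<in> set (eval_clauses g). horn_true M h) \<longrightarrow>
          M (EvalR g) (list_encode xs) y)) hs ws"
      "\<forall>h \<in> set (evals_clauses hs). horn_true M h" for hs ws
    using that
  proof (induction rule: list_all2_induct)
    case Nil
    then show ?case
      using horn_trueD[of M "[]" "EvalsR []" 1 0 "(!) [0, list_encode xs]"] by simp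
  next
    case (Cons g hs y ws)
    let ?ps = "[(EvalR g, 1, 2), (EvalsR hs, 1, 3), (HeadR, 4, 2), (TailR, 4, 3)]"
    show ?case
      using horn_trueD[of M ?ps "EvalsR (g # hs)" 1 4
          "(!) [0, list_encode xs, y, list_encode ws, list_encode (y # ws)]"]
        derive_Cons[of y ws] Cons by simp
  qed
  moreover have "\<forall>h \<in> set (evals_clauses gs). horn_true M h"
    using Comp.prems by simp
  moreover have "list_all2 (\<lambda>g y. rec_eval g xs y \<and> ((\<forall>h \<in> set (eval_clauses g). horn_true M h) \<longrightarrow>
      M (EvalR g) (list_encode xs) y)) gs ys"
    using Comp.IH(1) by (rule list_all2_mono) blast
  ultimately have "M (EvalsR gs) (list_encode xs) (list_encode ys)"
    by blast
  moreover have "M (EvalR f) (list_encode ys) z"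
    using Comp.IH(2) Comp.prems by simp
  ultimately show ?case
    using horn_trueD[OF Comp.prems, of "[(EvalsR gs, 1, 2), (EvalR f, 2, 3)]" "EvalR (Comp f gs)" 1 3
        "(!) [0, list_encode xs, list_encode ys, z]"]
    by simp
next
  case (Prec_0 f xs y g)
  let ?ps = "[(HeadR, 1, 0), (TailR, 1, 2), (EvalR f, 2, 3)]"
  show ?case
    using horn_trueD[OF Prec_0.prems, of ?ps "EvalR (Prec f g)" 1 3
        "(!) [0, list_encode (0 # xs), list_encode xs, y]"]
      derive_Cons[of 0 xs] Prec_0 by simp
next
  case (Prec_Suc f g n xs y z)
  let ?ps = "[(HeadR, 1, 2), (TailR, 1, 3), (SuccR, 4, 2),
      (HeadR, 5, 4), (TailR, 5, 3), (EvalR (Prec f g), 5, 6),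
      (HeadR, 7, 6), (TailR, 7, 3), (HeadR, 8, 4), (TailR, 8, 7), (EvalR g, 8, 9)]"
  show ?case
    using horn_trueD[OF Prec_Suc.prems, of ?ps "EvalR (Prec f g)" 1 9
        "(!) [0, list_encode (Suc n # xs), Suc n, list_encode xs, n, list_encode (n # xs), y,
          list_encode (y # xs), list_encode (n # y # xs), z]"]
      derive_Cons[of "Suc n" xs] derive_Cons[of n xs] derive_Cons[of y xs]
      derive_Cons[of n "y # xs"] Prec_Suc.IH Prec_Suc.prems succ[of n]
    by (simp del: list_encode.simps)
next
  case (Mu f n xs)
  have f: "M (EvalR f) (list_encode (n # xs)) 0"
    "\<And>i. i < n \<Longrightarrow> \<exists>y. M (EvalR f) (list_encode (i # xs)) (Suc y)"
    using Mu.IH Mu.prems by (auto simp del: list_encode.simps)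
  \<comment> \<open>The search is replayed upwards from 0. A value is recognised as positive by
    having a predecessor, here \<open>y\<close> for \<open>Suc y\<close>.\<close>
  have "M (BelowR f) (list_encode xs) m" if "m \<le> n" for m
    using that
  proof (induction m)
    case 0
    show ?case
      using horn_trueD[OF Mu.prems, of "[]" "BelowR f" 1 0 "(!) [0, list_encode xs]"] by simp
  next
    case (Suc m)
    then obtain y where "M (EvalR f) (list_encode (m # xs)) (Suc y)" using f(2)[of m] by auto
    then show ?case
      using horn_trueD[OF Mu.prems,
          of "[(BelowR f, 1, 2), (HeadR, 3, 2), (TailR, 3, 1), (EvalR f, 3, 4), (SuccR, 5, 4), (SuccR, 2, 6)]"
            "BelowR f" 1 6 "(!) [0, list_encode xs, m, list_encode (m # xs), Suc y, y, Suc m]"]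
        derive_Cons[of m xs] Suc succ[of m] succ[of y] by (simp del: list_encode.simps)
  qed
  then show ?case
    using horn_trueD[OF Mu.prems,
        of "[(BelowR f, 1, 2), (HeadR, 3, 2), (TailR, 3, 1), (EvalR f, 3, 0)]" "EvalR (Mu f)" 1 2
          "(!) [0, list_encode xs, n, list_encode (n # xs)]"]
      derive_Cons[of n xs] f(1) by (simp del: list_encode.simps)
qed

end

lemma derive_halt:
  assumes "\<And>n. M SuccR n (Suc n)" "\<And>h. h \<in> set (halt_clauses q) \<Longrightarrow> horn_true M h"
    and "rec_eval q [n] y"
  shows "M HaltR n n"
proof -
  have list_true: "horn_true M h" if "h \<in> set list_clauses" for h
    using that assms(2) by (simp add: halt_clauses_def)
  have "M (EvalR q) (list_encode [n]) y"
    using derive_eval[OF assms(1) list_true assms(3)] assms(2) by (simp add: halt_clauses_def)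
  then show ?thesis
    using horn_trueD[OF assms(2), of "[(HeadR, 1, 2), (TailR, 1, 0), (EvalR q, 1, 3)]" HaltR 2 2
        "(!) [0, list_encode [n], n, y]"]
      derive_Cons[OF assms(1) list_true, of n "[]"]
    by (simp add: halt_clauses_def)
qed

section \<open>Horn clauses as prenex formulae\<close>

text \<open>Set variable 0 denotes the set of numerals, and set variable 1 the number 0.\<close>

fun literal_atom :: "literal \<Rightarrow> atom" where
  "literal_atom (r, i, j) = PairMem (Suc i) (Suc j) (to_nat r)"

text \<open>Clause variable 0 is a constant and stays free. Repetitions in the list do no harm, as a
  repeated quantifier rebinds its variable within the same domain.\<close>

definition horn_vars :: "horn \<Rightarrow> nat list" where
  "horn_vars = (\<lambda>(ps, c). map Suc (filter (\<lambda>i. i \<noteq> 0) (concat (map (\<lambda>(r, i, j). [i, j]) (c # ps)))))"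

definition horn_prenex :: "horn \<Rightarrow> prenex" where
  "horn_prenex h = Prenex (map (\<lambda>i. (i, 0)) (horn_vars h)) []
    (foldr (\<lambda>p. Imp (Atom (literal_atom p))) (fst h) (Atom (literal_atom (snd h))))"

text \<open>Keeps the quantified variables apart from the variables for the domain and for the
  number 0.\<close>

lemma horn_vars_ge: "i \<in> set (horn_vars h) \<Longrightarrow> 2 \<le> i"
  by (auto simp: horn_vars_def)

lemma simple_horn_prenex: "simple (horn_prenex h)"
  by (auto simp: simple_def horn_prenex_def dest: horn_vars_ge)

text \<open>Nested variants collapse into a single one, as no quantifier changes the domain variable
  0.\<close>

lemma sat_quantified_all:
  assumes "0 \<notin> set is"
  shows "sat_quantified E I (map (\<lambda>i. (i, 0)) is) [] \<delta> \<longleftrightarrow>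
    (\<forall>J. variant (set is) I J \<and> (\<forall>i \<in> set is. E (sval J i) (sval I 0)) \<longrightarrow> sat_bform E J \<delta>)"
  using assms
proof (induction "is" arbitrary: I)
  case Nil
  have "variant {} I J \<longleftrightarrow> J = I" for J by (auto simp: variant_def fun_eq_iff)
  then show ?case by simp
next
  case (Cons i js)
  have "variant {i} I J \<and> E (sval J i) (sval J 0) \<and> variant (set js) J K \<and>
      (\<forall>j \<in> set js. E (sval K j) (sval J 0)) \<Longrightarrow>
    variant (set (i # js)) I K \<and> (\<forall>j \<in> set (i # js). E (sval K j) (sval I 0))" for J K
    using Cons.prems unfolding variant_def by (cases "i \<in> set js") auto
  moreover have "\<exists>J. variant {i} I J \<and> E (sval J i) (sval J 0) \<and> variant (set js) J K \<and>
      (\<forall>j \<in> set js. E (sval K j) (sval J 0))"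
    if "variant (set (i # js)) I K \<and> (\<forall>j \<in> set (i # js). E (sval K j) (sval I 0))" for K
    \<comment> \<open>The intermediate interpretation takes the final value of \<open>i\<close> at
      once.\<close>
    by (rule exI[of _ "I\<lparr>sval := (sval I)(i := sval K i)\<rparr>"])
      (use that Cons.prems in \<open>auto simp: variant_def\<close>)
  moreover have "0 \<notin> set js" using Cons.prems by simp
  note IH = Cons.IH[OF this]
  ultimately show ?case unfolding list.map sat_quantified.simps IH by blast
qed

lemma sat_bform_foldr_Imp:
  "sat_bform E I (foldr (\<lambda>p. Imp (Atom (literal_atom p))) ps \<delta>) \<longleftrightarrow>
    ((\<forall>(r, i, j) \<in> set ps. E (pair I (sval I (Suc i)) (sval I (Suc j))) (mval I (to_nat r))) \<longrightarrow>
      sat_bform E I \<delta>)"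
  by (induction ps) auto

text \<open>The domain may contain more than the elements \<open>e k\<close>: universal quantifiers
  can be restricted to the chain.\<close>

lemma sat_horn_prenexD:
  assumes "sat_prenex E I (horn_prenex h)" "e 0 = sval I 1" "\<And>k. E (e k) (sval I 0)"
  shows "horn_true (\<lambda>r a b. E (pair I (e a) (e b)) (mval I (to_nat r))) h"
proof -
  obtain ps r i j where h: "h = (ps, (r, i, j))" by (metis prod.exhaust)
  show ?thesis
    unfolding h horn_true_def prod.case
  proof (intro allI impI)
    fix w :: "nat \<Rightarrow> nat"
    assume w0: "w 0 = 0"
      and prems: "\<forall>(s, k, l) \<in> set ps. E (pair I (e (w k)) (e (w l))) (mval I (to_nat s))"
    \<comment> \<open>Realises \<open>w\<close> as a variant; \<open>k - 1\<close> undoes the shift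
      from clause variables to set variables.\<close>
    define J where "J = I\<lparr>sval := \<lambda>k. if k \<in> set (horn_vars h) then e (w (k - 1)) else sval I k\<rparr>"
    have "sat_bform E J (foldr (\<lambda>p. Imp (Atom (literal_atom p))) ps (Atom (literal_atom (r, i, j))))"
    proof -
      have "variant (set (horn_vars h)) I J" "\<forall>k \<in> set (horn_vars h). E (sval J k) (sval I 0)"
        using assms(3) by (auto simp: variant_def J_def)
      moreover have "0 \<notin> set (horn_vars h)" using horn_vars_ge by fastforce
      ultimately show ?thesis
        using assms(1) by (simp add: horn_prenex_def sat_quantified_all h)
    qed
    moreover have var: "sval J (Suc k) = e (w k)" if "k = 0 \<or> Suc k \<in> set (horn_vars h)" for k
    proof (cases "k = 0")
      case True
      have "Suc 0 \<notin> set (horn_vars h)" using horn_vars_ge by fastforce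
      then show ?thesis using True assms(2) w0 by (simp add: J_def)
    next
      case False
      then show ?thesis using that by (simp add: J_def)
    qed
    have "sval J (Suc k) = e (w k) \<and> sval J (Suc l) = e (w l)" if "(s, k, l) \<in> set ((r, i, j) # ps)" for s k l
      using that by (intro conjI var) (force simp: h horn_vars_def)+
    moreover have "pair J = pair I" "mval J = mval I" by (simp_all add: J_def)
    ultimately show "E (pair I (e (w i)) (e (w j))) (mval I (to_nat r))"
      using prems by (fastforce simp: sat_bform_foldr_Imp)
  qed
qed

text \<open>For the converse the chain must exhaust the domain, so that every variant comes from a
  valuation by natural numbers.\<close>

lemma sat_horn_prenexI:
  assumes "horn_true (\<lambda>r a b. E (pair I (e a) (e b)) (mval I (to_nat r))) h"
    and "e 0 = sval I 1" "\<And>t. E t (sval I 0) \<Longrightarrow> t \<in> range e"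
  shows "sat_prenex E I (horn_prenex h)"
proof -
  obtain ps r i j where h: "h = (ps, (r, i, j))" by (metis prod.exhaust)
  have 0: "0 \<notin> set (horn_vars h)" and 1: "1 \<notin> set (horn_vars h)"
    using horn_vars_ge by fastforce+
  have "sat_bform E J (foldr (\<lambda>p. Imp (Atom (literal_atom p))) ps (Atom (literal_atom (r, i, j))))"
    if J: "variant (set (horn_vars h)) I J" "\<forall>k \<in> set (horn_vars h). E (sval J k) (sval I 0)" for J
  proof -
    define w where "w k = (if k = 0 then 0 else SOME a. sval J (Suc k) = e a)" for k
    have var: "sval J (Suc k) = e (w k)" if "k = 0 \<or> Suc k \<in> set (horn_vars h)" for k
    proof (cases "k = 0")
      case True
      then show ?thesis using assms(2) J(1) 1 by (simp add: w_def variant_def)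
    next
      case False
      then have "\<exists>a. sval J (Suc k) = e a" using that J(2) assms(3) by blast
      then show ?thesis using False someI_ex by (simp add: w_def)
    qed
    have vars: "sval J (Suc k) = e (w k) \<and> sval J (Suc l) = e (w l)" if "(s, k, l) \<in> set ((r, i, j) # ps)" for s k l
      using that by (intro conjI var) (force simp: h horn_vars_def)+
    have "pair J = pair I" "mval J = mval I" using J(1) by (simp_all add: variant_def)
    moreover have "w 0 = 0" by (simp add: w_def)
    ultimately show ?thesis
      using horn_trueD[OF assms(1)[unfolded h], of w] vars by (fastforce simp: sat_bform_foldr_Imp)
  qed
  then show ?thesis
    by (simp add: horn_prenex_def sat_quantified_all[OF 0[unfolded h]] h)
qed

section \<open>The formula expressing divergence\<close>

text \<open>Set variables 1 to \<open>Suc n\<close> form a successor chain, so that the last one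
  stands for the input; \<open>SEq 0 0\<close> serves as truth.\<close>

fun chain_form :: "nat \<Rightarrow> bform" where
  "chain_form 0 = Atom (SEq 0 0)"
| "chain_form (Suc k) = Conj (Atom (PairMem (Suc k) (Suc (Suc k)) (to_nat SuccR))) (chain_form k)"

definition input_prenex :: "nat \<Rightarrow> prenex" where
  "input_prenex n =
    Prenex [] [] (Conj (Neg (Atom (PairMem (Suc n) (Suc n) (to_nat HaltR)))) (chain_form n))"

text \<open>The formula with \<open>Mem 3 0\<close> closes the set of numerals under successors, so
  that the domain literal can be applied over and over.\<close>

definition program_prenexes :: "recf \<Rightarrow> prenex list" where
  "program_prenexes q =
    Prenex [] [] (Atom (Mem 1 0)) #
    Prenex [] [(2, 3, to_nat SuccR)] (Atom (Mem 3 0)) #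
    map horn_prenex (halt_clauses q)"

definition diverge_formula :: "recf \<Rightarrow> nat \<Rightarrow> formula" where
  "diverge_formula q n =
    WithDom (input_prenex n # program_prenexes q) 0 (to_nat SuccR) 0 (to_nat SuccR)"

lemma diverge_formula_in_dom_formulae: "diverge_formula q n \<in> dom_formulae"
  by (auto simp: diverge_formula_def dom_formulae_def normalized_conjunction_def
      program_prenexes_def input_prenex_def simple_horn_prenex) (auto simp: simple_def)

lemma sat_chain_form:
  "sat_bform E I (chain_form n) \<longleftrightarrow>
    (\<forall>k<n. E (pair I (sval I (Suc k)) (sval I (Suc (Suc k)))) (mval I (to_nat SuccR)))"
  by (induction n) (auto simp: less_Suc_eq)

text \<open>The domain literal yields a chain of numerals in any model. Along it a halting
  computation would derive the very \<open>HaltR\<close> atom that the input part denies.\<close>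

lemma diverges_if_satisfiable:
  assumes "satisfiable E (diverge_formula q n)"
  shows "\<not> rec_eval q [n] y"
proof
  assume halts: "rec_eval q [n] y"
  from assms obtain I where I: "sat_formula E I (diverge_formula q n)"
    unfolding satisfiable_def by blast
  define S where "S a b \<longleftrightarrow> E (pair I a b) (mval I (to_nat SuccR))" for a b
  have input: "\<not> E (pair I (sval I (Suc n)) (sval I (Suc n))) (mval I (to_nat HaltR))"
      "\<And>k. k < n \<Longrightarrow> S (sval I (Suc k)) (sval I (Suc (Suc k)))"
    and zero: "E (sval I 1) (sval I 0)"
    and dom: "\<And>a. E a (sval I 0) \<Longrightarrow> \<exists>b. S a b"
    and clauses: "\<And>h. h \<in> set (halt_clauses q) \<Longrightarrow> sat_prenex E I (horn_prenex h)"
    using I by (auto simp: diverge_formula_def input_prenex_def program_prenexes_def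
        sat_chain_form sat_subset_dom_def S_def)
  have range: "E b (sval I 0)" if "S a b" for a b
  proof -
    have "sat_prenex E I (Prenex [] [(2, 3, to_nat SuccR)] (Atom (Mem 3 0)))"
      using I by (simp add: diverge_formula_def program_prenexes_def)
    then show ?thesis
      using that by (auto simp: variant_def S_def dest!: spec[of _ "I\<lparr>sval := (sval I)(2 := a, 3 := b)\<rparr>"])
  qed
  \<comment> \<open>The successor relation of the model need not be functional. So the chain first
    runs through the input variables, which makes \<open>e n\<close> the element named there, and is
    continued by choice only from index n + 1 on.\<close>
  define e where
    "e = rec_nat (sval I 1) (\<lambda>k a. if k < n then sval I (Suc (Suc k)) else SOME b. S a b)"
  have e_le: "e k = sval I (Suc k)" if "k \<le> n" for k
    using that by (cases k) (auto simp: e_def)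
  have step: "E (e k) (sval I 0) \<and> S (e k) (e (Suc k))" for k
  proof (induction k)
    case 0
    then show ?case
      using zero dom[OF zero] input(2)[of 0] by (auto simp: e_def intro: someI_ex)
  next
    case (Suc k)
    then have mem: "E (e (Suc k)) (sval I 0)" using range by blast
    show ?case
    proof (cases "Suc k < n")
      case True
      then show ?thesis using mem input(2)[of "Suc k"] e_le[of "Suc k"] e_le[of "Suc (Suc k)"] by simp
    next
      case False
      then have "e (Suc (Suc k)) = (SOME b. S (e (Suc k)) b)" by (simp add: e_def)
      then show ?thesis using mem dom[OF mem] by (simp add: someI_ex)
    qed
  qed
  have "E (pair I (e n) (e n)) (mval I (to_nat HaltR))"
    using derive_halt[of "\<lambda>r a b. E (pair I (e a) (e b)) (mval I (to_nat r))" q n y]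
      sat_horn_prenexD[OF clauses, of _ e] step halts e_le[of 0]
    by (simp add: S_def)
  then show False using input(1) e_le[of n] by simp
qed

section \<open>The standard model\<close>

context zf_universe
begin

lemma image_set: "\<exists>c. \<forall>t. E t c \<longleftrightarrow> (\<exists>s. E s a \<and> t = g s)"
  by (rule replacement) simp

lemma separation: "\<exists>c. \<forall>t. E t c \<longleftrightarrow> E t a \<and> P t"
proof -
  have "\<exists>c. \<forall>t. E t c \<longleftrightarrow> (\<exists>s. E s a \<and> s = t \<and> P s)"
    by (rule replacement) simp
  then show ?thesis by blast
qed

text \<open>Regularity for the singleton of \<open>x\<close>, which would share the member
  \<open>x\<close> with \<open>x\<close>.\<close>

lemma mem_irrefl: "\<not> E x x"
proof
  assume x: "E x x"
  obtain c where "\<And>t. E t c \<longleftrightarrow> t = x" using pairing[of x x] by auto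
  then show False using regularity[of x c] x by metis
qed

text \<open>Kuratowski pairs. The product of two sets is the union of its rows, one row for each
  first component.\<close>

lemma ex_pairing_function: "\<exists>\<pi>. pairing_function E \<pi>"
proof -
  obtain up where up: "\<And>a b t. E t (up a b) \<longleftrightarrow> t = a \<or> t = b"
    using pairing by metis
  define \<pi> where "\<pi> a b = up (up a a) (up a b)" for a b
  have up_eq: "up a b = up c d \<longleftrightarrow> a = c \<and> b = d \<or> a = d \<and> b = c" for a b c d
  proof -
    have members: "{t. E t (up a b)} = {a, b}" for a b by (auto simp: up)
    have "up a b = up c d \<longleftrightarrow> {t. E t (up a b)} = {t. E t (up c d)}"
      by (metis (full_types) mem_Collect_eq extensionality)
    then show ?thesis unfolding members doubleton_eq_iff .
  qed
  have "\<pi> u v = \<pi> u' v' \<longleftrightarrow> u = u' \<and> v = v'" for u v u' v'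
    unfolding \<pi>_def up_eq by auto
  moreover have "\<exists>w. \<forall>t. E t w \<longleftrightarrow> (\<exists>u' v'. E u' u \<and> E v' v \<and> t = \<pi> u' v')" for u v
  proof -
    have "\<forall>u'. \<exists>r. \<forall>t. E t r \<longleftrightarrow> (\<exists>v'. E v' v \<and> t = \<pi> u' v')"
      by (intro allI image_set)
    then obtain row where row: "\<And>u' t. E t (row u') \<longleftrightarrow> (\<exists>v'. E v' v \<and> t = \<pi> u' v')"
      by (auto dest!: choice)
    obtain rows where rows: "\<And>t. E t rows \<longleftrightarrow> (\<exists>u'. E u' u \<and> t = row u')"
      using image_set[of u row] by blast
    obtain w where w: "\<And>t. E t w \<longleftrightarrow> (\<exists>s. E s rows \<and> E t s)"
      using union[of rows] by blast
    have "E t w \<longleftrightarrow> (\<exists>u'. E u' u \<and> E t (row u'))" for t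
      unfolding w rows by blast
    then have "E t w \<longleftrightarrow> (\<exists>u' v'. E u' u \<and> E v' v \<and> t = \<pi> u' v')" for t
      unfolding row by blast
    then show ?thesis by blast
  qed
  ultimately show ?thesis unfolding pairing_function_def by blast
qed

text \<open>Von Neumann numerals: each is the set of the earlier ones, so two equal ones would give
  a member of itself.\<close>

lemma ex_omega: "\<exists>(e :: nat \<Rightarrow> 'v) N. inj e \<and> (\<forall>t. E t N \<longleftrightarrow> t \<in> range e)"
proof -
  obtain c z where z: "E z c" "\<And>t. \<not> E t z"
    and c: "\<And>s. E s c \<Longrightarrow> \<exists>s'. E s' c \<and> (\<forall>t. E t s' \<longleftrightarrow> E t s \<or> t = s)"
    using infinity by metis
  obtain sc where sc: "\<And>s. E s c \<Longrightarrow> E (sc s) c" "\<And>s t. E s c \<Longrightarrow> E t (sc s) \<longleftrightarrow> E t s \<or> t = s"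
    using c by metis
  define e where "e n = (sc ^^ n) z" for n
  have e_c: "E (e n) c" for n by (induction n) (auto simp: e_def z sc)
  have e_mem: "E t (e n) \<longleftrightarrow> (\<exists>m<n. t = e m)" for t n
  proof (induction n)
    case 0
    then show ?case by (simp add: e_def z)
  next
    case (Suc n)
    have "E t (e (Suc n)) \<longleftrightarrow> E t (e n) \<or> t = e n"
      using sc(2)[OF e_c] by (simp add: e_def)
    then show ?case using Suc by (auto simp: less_Suc_eq)
  qed
  have "e m \<noteq> e n" if "m < n" for m n
    using e_mem mem_irrefl that by metis
  then have "inj e" by (metis injI linorder_less_linear)
  \<comment> \<open>The numerals are indexed by the type \<open>nat\<close> of the logic; separation
    admits any predicate, so that \<open>range e\<close> is a set.\<close>
  moreover obtain N where "\<And>t. E t N \<longleftrightarrow> E t c \<and> t \<in> range e"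
    using separation[of c "\<lambda>t. t \<in> range e"] by metis
  ultimately show ?thesis using e_c by blast
qed

text \<open>The standard relations, transported along \<open>e\<close>, satisfy all clauses, while
  divergence makes the denied \<open>HaltR\<close> atom false.\<close>

lemma satisfiable_if_diverges:
  assumes "\<And>y. \<not> rec_eval q [n] y"
  shows "satisfiable E (diverge_formula q n)"
proof -
  obtain \<pi> where \<pi>: "pairing_function E \<pi>" using ex_pairing_function by blast
  then have \<pi>_eq: "\<pi> u v = \<pi> u' v' \<longleftrightarrow> u = u' \<and> v = v'" for u v u' v'
    unfolding pairing_function_def by blast
  obtain e :: "nat \<Rightarrow> 'v" and N where e: "inj e" "\<And>t. E t N \<longleftrightarrow> t \<in> range e"
    using ex_omega by metis
  have "\<exists>c. \<forall>t. E t c \<longleftrightarrow> (\<exists>a b. t = \<pi> (e a) (e b) \<and> R a b)" for R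
  proof -
    obtain NN where "\<And>t. E t NN \<longleftrightarrow> (\<exists>u v. E u N \<and> E v N \<and> t = \<pi> u v)"
      using \<pi> unfolding pairing_function_def by metis
    then have NN: "E t NN \<longleftrightarrow> (\<exists>a b. t = \<pi> (e a) (e b))" for t
      by (auto simp: e)
    obtain c where c: "\<And>t. E t c \<longleftrightarrow> E t NN \<and> (\<exists>a b. t = \<pi> (e a) (e b) \<and> R a b)"
      using separation[of NN "\<lambda>t. \<exists>a b. t = \<pi> (e a) (e b) \<and> R a b"] by metis
    then have "E t c \<longleftrightarrow> (\<exists>a b. t = \<pi> (e a) (e b) \<and> R a b)" for t
      by (auto simp: NN)
    then show ?thesis by blast
  qed
  then obtain graph where graph: "\<And>R t. E t (graph R) \<longleftrightarrow> (\<exists>a b. t = \<pi> (e a) (e b) \<and> R a b)"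
    by metis
  \<comment> \<open>Every map variable denotes a graph, hence a set of pairs;
    \<open>from_nat\<close> recovers the relation symbol. Set variable \<open>Suc k\<close> denotes
    the numeral k, which makes the input chain true.\<close>
  define I where "I = \<lparr>sval = (\<lambda>i. case i of 0 \<Rightarrow> N | Suc k \<Rightarrow> e k),
    mval = (\<lambda>f. graph (std_rel q (from_nat f))), pair = \<pi>\<rparr>"
  have rel: "E (pair I (e a) (e b)) (mval I (to_nat r)) \<longleftrightarrow> std_rel q r a b" for r a b
    using e(1) by (auto simp: I_def graph \<pi>_eq inj_eq)
  have pair_I: "pair I = \<pi>" by (simp add: I_def)
  have sval: "sval I 0 = N" "sval I (Suc k) = e k" for k by (simp_all add: I_def)
  have "interpretation_in E I"
    using \<pi> by (auto simp: interpretation_in_def I_def graph)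
  moreover have "sat_prenex E I (horn_prenex h)" if "h \<in> set (halt_clauses q)" for h
    by (rule sat_horn_prenexI[of E I e]) (use std_halt_clauses[OF that] in \<open>simp_all add: rel sval e\<close>)
  moreover have "sat_prenex E I (Prenex [] [(2, 3, to_nat SuccR)] (Atom (Mem 3 0)))"
  proof -
    have mem: "E b N" if "E (\<pi> a b) (mval I (to_nat SuccR))" for a b
      using that by (auto simp: I_def graph \<pi>_eq e)
    have "E (sval J 3) (sval J 0)"
      if "variant {2, 3} I J" "E (pair J (sval J 2) (sval J 3)) (mval J (to_nat SuccR))" for J
      using that mem[of "sval J 2" "sval J 3"] by (simp add: variant_def sval pair_I)
    then show ?thesis by simp
  qed
  moreover have "sat_prenex E I (input_prenex n)"
    using assms by (simp add: input_prenex_def sat_chain_form rel sval)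
  moreover have "sat_subset_dom E I 0 (to_nat SuccR)"
  proof -
    have "\<exists>v. E (pair I (e a) v) (mval I (to_nat SuccR))" for a
      using rel[of a "Suc a" SuccR] by auto
    then show ?thesis by (auto simp: sat_subset_dom_def sval e(2))
  qed
  moreover have "sat_prenex E I (Prenex [] [] (Atom (Mem 1 0)))"
    by (simp add: sval e(2))
  ultimately have "sat_formula E I (diverge_formula q n)"
    by (auto simp: diverge_formula_def program_prenexes_def simp del: sat_prenex.simps)
  with \<open>interpretation_in E I\<close> show ?thesis unfolding satisfiable_def by blast
qed

end

section \<open>Computability of the formula\<close>

definition computable1 :: "(nat \<Rightarrow> nat) \<Rightarrow> bool" where
  "computable1 f \<longleftrightarrow> (\<exists>p. \<forall>x. rec_eval p [x] (f x))"

definition computable2 :: "(nat \<Rightarrow> nat \<Rightarrow> nat) \<Rightarrow> bool" where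
  "computable2 f \<longleftrightarrow> (\<exists>p. \<forall>x y. rec_eval p [x, y] (f x y))"

section \<open>Closure properties of computable functions\<close>

lemma rec_eval_Proj_0: "rec_eval (Proj 0) (x # xs) x"
  using rec_eval.Proj[of 0 "x # xs"] by simp

lemma rec_eval_Proj_1: "rec_eval (Proj 1) (x # y # xs) y"
  using rec_eval.Proj[of 1 "x # y # xs"] by simp

lemma rec_eval_Comp1: "rec_eval g xs y \<Longrightarrow> rec_eval f [y] z \<Longrightarrow> rec_eval (Comp f [g]) xs z"
  by (rule rec_eval.Comp[where ys = "[y]"]) simp_all

lemma rec_eval_Comp2:
  "rec_eval g xs y \<Longrightarrow> rec_eval h xs z \<Longrightarrow> rec_eval f [y, z] u \<Longrightarrow> rec_eval (Comp f [g, h]) xs u"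
  by (rule rec_eval.Comp[where ys = "[y, z]"]) simp_all

lemma ex_rec_eval_const: "\<exists>p. \<forall>xs. rec_eval p xs c"
proof (induction c)
  case 0
  then show ?case using rec_eval.Zero by blast
next
  case (Suc c)
  then show ?case using rec_eval_Comp1 rec_eval.Succ by metis
qed

lemma computable1_const: "computable1 (\<lambda>x. c)"
  using ex_rec_eval_const[of c] unfolding computable1_def by blast

lemma computable1_id: "computable1 (\<lambda>x. x)"
  using rec_eval_Proj_0 unfolding computable1_def by blast

lemma computable1_comp1: "computable1 f \<Longrightarrow> computable1 g \<Longrightarrow> computable1 (\<lambda>x. f (g x))"
proof -
  assume "computable1 f" "computable1 g"
  then obtain p r where "\<And>x. rec_eval p [x] (f x)" "\<And>x. rec_eval r [x] (g x)"
    unfolding computable1_def by blast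
  then have "rec_eval (Comp p [r]) [x] (f (g x))" for x by (intro rec_eval_Comp1)
  then show ?thesis unfolding computable1_def by blast
qed

lemma computable1_comp2:
  "computable2 f \<Longrightarrow> computable1 g \<Longrightarrow> computable1 h \<Longrightarrow> computable1 (\<lambda>x. f (g x) (h x))"
proof -
  assume "computable2 f" "computable1 g" "computable1 h"
  then obtain p r s where "\<And>x y. rec_eval p [x, y] (f x y)"
    "\<And>x. rec_eval r [x] (g x)" "\<And>x. rec_eval s [x] (h x)"
    unfolding computable1_def computable2_def by blast
  then have "rec_eval (Comp p [r, s]) [x] (f (g x) (h x))" for x by (intro rec_eval_Comp2)
  then show ?thesis unfolding computable1_def by blast
qed

lemma computable2_fst: "computable1 f \<Longrightarrow> computable2 (\<lambda>x y. f x)"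
proof -
  assume "computable1 f"
  then obtain p where "\<And>x. rec_eval p [x] (f x)"
    unfolding computable1_def by blast
  then have "rec_eval (Comp p [Proj 0]) [x, y] (f x)" for x y
    by (intro rec_eval_Comp1[OF rec_eval_Proj_0])
  then show ?thesis unfolding computable2_def by blast
qed

lemma computable2_snd: "computable1 f \<Longrightarrow> computable2 (\<lambda>x y. f y)"
proof -
  assume "computable1 f"
  then obtain p where "\<And>x. rec_eval p [x] (f x)"
    unfolding computable1_def by blast
  then have "rec_eval (Comp p [Proj 1]) [x, y] (f y)" for x y
    by (intro rec_eval_Comp1[OF rec_eval_Proj_1])
  then show ?thesis unfolding computable2_def by blast
qed

lemma computable2_comp1: "computable1 f \<Longrightarrow> computable2 g \<Longrightarrow> computable2 (\<lambda>x y. f (g x y))"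
proof -
  assume "computable1 f" "computable2 g"
  then obtain p r where "\<And>x. rec_eval p [x] (f x)" "\<And>x y. rec_eval r [x, y] (g x y)"
    unfolding computable1_def computable2_def by blast
  then have "rec_eval (Comp p [r]) [x, y] (f (g x y))" for x y by (intro rec_eval_Comp1)
  then show ?thesis unfolding computable2_def by blast
qed

lemma computable2_comp2:
  "computable2 f \<Longrightarrow> computable2 g \<Longrightarrow> computable2 h \<Longrightarrow> computable2 (\<lambda>x y. f (g x y) (h x y))"
proof -
  assume "computable2 f" "computable2 g" "computable2 h"
  then obtain p r s where "\<And>x y. rec_eval p [x, y] (f x y)"
    "\<And>x y. rec_eval r [x, y] (g x y)" "\<And>x y. rec_eval s [x, y] (h x y)"
    unfolding computable2_def by blast
  then have "rec_eval (Comp p [r, s]) [x, y] (f (g x y) (h x y))" for x y by (intro rec_eval_Comp2)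
  then show ?thesis unfolding computable2_def by blast
qed

lemma computable1_Suc: "computable1 f \<Longrightarrow> computable1 (\<lambda>x. Suc (f x))"
  by (rule computable1_comp1) (use rec_eval.Succ in \<open>auto simp: computable1_def\<close>)

lemma computable1_rec:
  assumes "computable2 g" "\<And>n. f (Suc n) = g n (f n)"
  shows "computable1 f"
proof -
  obtain p where p: "\<And>n y. rec_eval p [n, y] (g n y)"
    using assms(1) unfolding computable2_def by blast
  obtain z where z: "\<And>xs. rec_eval z xs (f 0)" using ex_rec_eval_const by blast
  have "rec_eval (Prec z p) [n] (f n)" for n
    by (induction n) (auto intro: rec_eval.Prec_0 rec_eval.Prec_Suc z p simp: assms(2))
  then show ?thesis unfolding computable1_def by blast
qed

section \<open>Arithmetic of the coding\<close>

lemma computable2_add: "computable2 (+)"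
proof -
  have "rec_eval (Prec (Proj 0) (Comp Succ [Proj 1])) [m, n] (m + n)" for m n
    by (induction m)
      (auto intro: rec_eval.Prec_0 rec_eval.Prec_Suc rec_eval_Proj_0 rec_eval_Comp1 rec_eval_Proj_1 rec_eval.Succ
        simp del: One_nat_def)
  then show ?thesis unfolding computable2_def by blast
qed

lemma computable1_triangle: "computable1 triangle"
proof (rule computable1_rec)
  show "computable2 (\<lambda>n y. y + Suc n)"
    by (intro computable2_comp2[OF computable2_add] computable2_fst computable2_snd
        computable1_id computable1_Suc)
qed simp

lemma computable2_prod_encode: "computable2 (\<lambda>x y. prod_encode (x, y))"
  unfolding prod_encode_def prod.case
  by (intro computable2_comp2[OF computable2_add] computable2_comp1[OF computable1_triangle]
      computable2_add computable2_fst computable1_id)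

lemmas computable_intros =
  computable1_const computable1_id computable1_Suc
  computable1_comp2[OF computable2_prod_encode] computable2_comp2[OF computable2_prod_encode]

lemma computable1_chain_form: "computable1 (\<lambda>n. code_bform (chain_form n))"
proof (rule computable1_rec)
  show "computable2 (\<lambda>k c. prod_encode (2, prod_encode
      (prod_encode (0, code_atom (PairMem (Suc k) (Suc (Suc k)) (to_nat SuccR))), c)))"
    unfolding code_atom.simps
    by (intro computable2_comp2[OF computable2_prod_encode] computable2_snd[OF computable1_id]
        computable2_fst[where f = "\<lambda>x. _ x"] computable_intros)
qed simp

lemma computable1_input_prenex: "computable1 (\<lambda>n. code_prenex (input_prenex n))"
  unfolding input_prenex_def code_prenex.simps code_bform.simps code_atom.simps
  by (intro computable_intros computable1_chain_form)

text \<open>Prepending to \<open>list_decode c\<close> only pairs the code of the new head with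
  \<open>c\<close> itself and adds one, so no list is ever decoded.\<close>

lemma computable1_diagonal:
  "computable1 (\<lambda>c. prod_encode (list_encode (code_prenex (input_prenex c) # list_decode c), d))"
  by (simp, intro computable_intros computable1_input_prenex)

text \<open>On the code of its own clauses, \<open>Mu body\<close> halts iff the formula asserting
  its divergence there is satisfiable, that is, iff it diverges.\<close>

theorem theorem8:
  fixes E :: "'v \<Rightarrow> 'v \<Rightarrow> bool"
  assumes "zf_universe E"
  shows "\<not> decidable_problem code_formula dom_formulae (satisfiable E)"
proof
  assume "decidable_problem code_formula dom_formulae (satisfiable E)"
  then obtain p where p: "\<And>\<chi>. \<chi> \<in> dom_formulae \<Longrightarrow>
      rec_eval p [code_formula \<chi>] (if satisfiable E \<chi> then 1 else 0)"
    unfolding decidable_problem_def by blast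
  define F where "F c = prod_encode (list_encode (code_prenex (input_prenex c) # list_decode c),
    prod_encode (prod_encode (0, to_nat SuccR), prod_encode (0, to_nat SuccR)))" for c
  obtain k where k: "\<And>c. rec_eval k [c] (F c)"
    using computable1_diagonal unfolding computable1_def F_def by blast
  \<comment> \<open>Negation of the answer by primitive recursion: the base value is 1 and every
    step returns 0.\<close>
  obtain no where no: "\<And>b. rec_eval no [if b then 1 else 0] (if b then 0 else 1)"
  proof
    have "rec_eval (Comp Succ [Zero]) [] (Suc 0)"
      by (rule rec_eval_Comp1[OF rec_eval.Zero rec_eval.Succ])
    then have "rec_eval (Prec (Comp Succ [Zero]) Zero) [0] (Suc 0)"
      by (rule rec_eval.Prec_0)
    moreover from this have "rec_eval (Prec (Comp Succ [Zero]) Zero) [Suc 0] 0"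
      by (rule rec_eval.Prec_Suc) (rule rec_eval.Zero)
    ultimately show "rec_eval (Prec (Comp Succ [Zero]) Zero) [if b then 1 else 0] (if b then 0 else 1)" for b
      by simp
  qed
  \<comment> \<open>\<open>Proj 1\<close> skips the search variable, so on the input
    \<open>c\<close> below the search stops at 0 or never.\<close>
  define body where "body = Comp no [Comp p [Comp k [Proj 1]]]"
  define c where "c = list_encode (map code_prenex (program_prenexes (Mu body)))"
  have "F c = code_formula (diverge_formula (Mu body) c)"
    by (simp add: F_def c_def diverge_formula_def)
  then have body: "rec_eval body [i, c] (if satisfiable E (diverge_formula (Mu body) c) then 0 else 1)" for i
    unfolding body_def
    by (intro rec_eval_Comp1[OF _ no] rec_eval_Comp1[OF _ p] rec_eval_Comp1[OF rec_eval_Proj_1])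
      (use k[of c] diverge_formula_in_dom_formulae in auto)
  show False
  proof (cases "satisfiable E (diverge_formula (Mu body) c)")
    case True
    then have "rec_eval (Mu body) [c] 0" using body[of 0] by (intro rec_eval.Mu) auto
    then show False using diverges_if_satisfiable[OF True] by blast
  next
    case False
    then obtain y where "rec_eval (Mu body) [c] y"
      using zf_universe.satisfiable_if_diverges[OF assms] by blast
    \<comment> \<open>A search that halts has found the value 0, but in this case
      \<open>body\<close> only takes the value 1.\<close>
    then have "rec_eval body [y, c] 0" by (cases rule: rec_eval.cases) auto
    then show False using body[of y] False rec_eval_deterministic by fastforce
  qed
qed

end
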